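(* Let $n$ be an odd positive integer, $S=\{0,\dots,n-1\}$, and let $\alpha_1,\alpha_2,\alpha_3,\alpha_4\in\{1,\dots,n-1\}$. Define the $n\times n\times n\times n$ array $H$ by $H_{ijk\ell}\equiv\alpha_1 i+\alpha_2 j+\alpha_3 k+\alpha_4\ell\pmod n$, $i,j,k,\ell\in S$, $H_{ijk\ell}\in S$. Let $B=\alpha_1+\alpha_2+\alpha_3+\alpha_4$ and suppose that for all $m\in\{1,2,3,4\}$ and all $m'\in\{1,2,3,4\}$ with $m'\ne m$: $\gcd(\alpha_m,n)=1$; $\gcd(\alpha_m+\alpha_{m'},n)=1$; $\gcd(\alpha_m-\alpha_{m'},n)=1$; $\gcd(B-\alpha_m,n)=1$; $\gcd(B,n)=1$; $\gcd(B-2\alpha_m,n)=1$; $\gcd(B-\alpha_{m'}-2\alpha_m,n)=1$; $\gcd(B-2\alpha_{m'}-2\alpha_m,n)=1$. Then $H$ is a 4-D pandiagonal latin cube.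
   Context: An $n\times n$ array $(A_{xy})_{x,y\in S}$ with entries in $S$ is a pandiagonal latin square if for each $c\in S$ each of the index sets $\{(x,c)\}_x$, $\{(c,y)\}_y$, $\{(x,x+c\bmod n)\}_x$, $\{(x,c-x\bmod n)\}_x$ contains each element of $S$ exactly once among its entries. An $n\times n\times n$ array $(C_{xyz})$ with entries in $S$ is a pandiagonal latin cube if each of its $3n+6$ constituent squares is a pandiagonal latin square, where these squares are the $3n$ squares obtained by fixing one coordinate, and the six squares obtained by imposing, for one pair of coordinates $(a,b)$, either $x_a=x_b$ or $x_a+x_b=n-1$ (indexed by the remaining free coordinates). An $n\times n\times n\times n$ array $H$ with entries in $S$ is a 4-D pandiagonal latin cube if each of its $4n+12$ constituent 3-D cubes is a pandiagonal latin cube, where these are the $4n$ cubes obtained by fixing one of the four coordinates, and the $12$ cubes obtained by imposing, for one of the $6$ pairs of coordinates $(a,b)$, either $x_a=x_b$ or $x_a+x_b=n-1$ (indexed by the three remaining free coordinates, with $x_b$ determined by $x_a$). *)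

theory Defs
  imports "HOL-Number_Theory.Cong"
begin

text \<open>Arrays are functions on the integers, of which only the values at indices in
  \<open>symbols n\<close> matter.\<close>

definition symbols :: "int \<Rightarrow> int set" where
  "symbols n = {0..n - 1}"

definition each_once :: "int \<Rightarrow> (int \<Rightarrow> int) \<Rightarrow> bool" where
  "each_once n f \<longleftrightarrow> (\<forall>s\<in>symbols n. \<exists>!x. x \<in> symbols n \<and> f x = s)"

definition pandiagonal_latin_square :: "int \<Rightarrow> (int \<Rightarrow> int \<Rightarrow> int) \<Rightarrow> bool" where
  "pandiagonal_latin_square n A \<longleftrightarrow>
     (\<forall>x\<in>symbols n. \<forall>y\<in>symbols n. A x y \<in> symbols n) \<and>
     (\<forall>c\<in>symbols n.
        each_once n (\<lambda>x. A x c) \<and>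
        each_once n (\<lambda>y. A c y) \<and>
        each_once n (\<lambda>x. A x ((x + c) mod n)) \<and>
        each_once n (\<lambda>x. A x ((c - x) mod n)))"

text \<open>A condition relating the coordinates \<open>a < b\<close> eliminates coordinate \<open>b\<close>; the
  remaining coordinates keep their order.\<close>

definition constituent_squares ::
    "int \<Rightarrow> (int \<Rightarrow> int \<Rightarrow> int \<Rightarrow> int) \<Rightarrow> (int \<Rightarrow> int \<Rightarrow> int) set" where
  "constituent_squares n C =
     (\<Union>c\<in>symbols n.
        {(\<lambda>y z. C c y z),
         (\<lambda>x z. C x c z),
         (\<lambda>x y. C x y c)}) \<union>
     {(\<lambda>x z. C x x z), (\<lambda>x z. C x (n - 1 - x) z),
      (\<lambda>x y. C x y x), (\<lambda>x y. C x y (n - 1 - x)),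
      (\<lambda>x y. C x y y), (\<lambda>x y. C x y (n - 1 - y))}"

definition pandiagonal_latin_cube :: "int \<Rightarrow> (int \<Rightarrow> int \<Rightarrow> int \<Rightarrow> int) \<Rightarrow> bool" where
  "pandiagonal_latin_cube n C \<longleftrightarrow>
     (\<forall>x\<in>symbols n. \<forall>y\<in>symbols n. \<forall>z\<in>symbols n. C x y z \<in> symbols n) \<and>
     (\<forall>A\<in>constituent_squares n C. pandiagonal_latin_square n A)"

definition constituent_cubes ::
    "int \<Rightarrow> (int \<Rightarrow> int \<Rightarrow> int \<Rightarrow> int \<Rightarrow> int) \<Rightarrow> (int \<Rightarrow> int \<Rightarrow> int \<Rightarrow> int) set" where
  "constituent_cubes n H =
     (\<Union>c\<in>symbols n.
        {(\<lambda>j k l. H c j k l),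
         (\<lambda>i k l. H i c k l),
         (\<lambda>i j l. H i j c l),
         (\<lambda>i j k. H i j k c)}) \<union>
     {(\<lambda>i k l. H i i k l), (\<lambda>i k l. H i (n - 1 - i) k l),
      (\<lambda>i j l. H i j i l), (\<lambda>i j l. H i j (n - 1 - i) l),
      (\<lambda>i j k. H i j k i), (\<lambda>i j k. H i j k (n - 1 - i)),
      (\<lambda>i j l. H i j j l), (\<lambda>i j l. H i j (n - 1 - j) l),
      (\<lambda>i j k. H i j k j), (\<lambda>i j k. H i j k (n - 1 - j)),
      (\<lambda>i j k. H i j k k), (\<lambda>i j k. H i j k (n - 1 - k))}"

definition pandiagonal_latin_cube_4D ::
    "int \<Rightarrow> (int \<Rightarrow> int \<Rightarrow> int \<Rightarrow> int \<Rightarrow> int) \<Rightarrow> bool" where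
  "pandiagonal_latin_cube_4D n H \<longleftrightarrow>
     (\<forall>i\<in>symbols n. \<forall>j\<in>symbols n. \<forall>k\<in>symbols n. \<forall>l\<in>symbols n.
        H i j k l \<in> symbols n) \<and>
     (\<forall>C\<in>constituent_cubes n H. pandiagonal_latin_cube n C)"

end

theory Submission
  imports Defs
begin

text \<open>On every line that has to be tested, each coordinate is congruent to a constant or to
  the running index \<open>x\<close> up to sign and translation. Hence the entry is congruent to
  \<open>a * x + d\<close>, where \<open>a\<close> is a combination of the \<open>\<alpha>\<^sub>m\<close> with coefficients in \<open>{-1, 0, 1}\<close>,
  not all zero. Up to a global sign, the gcd hypotheses list exactly these combinations, so
  \<open>a\<close> is a unit modulo \<open>n\<close> and the line contains every symbol exactly once.\<close>

section \<open>Coprimality of signed combinations of coefficients\<close>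

definition signed_coprime2 :: "int \<Rightarrow> int \<Rightarrow> int \<Rightarrow> bool" where
  "signed_coprime2 n a b \<longleftrightarrow>
     (\<forall>e\<in>{-1,0,1}. \<forall>f\<in>{-1,0,1}. e \<noteq> 0 \<or> f \<noteq> 0 \<longrightarrow> coprime (e * a + f * b) n)"

definition signed_coprime3 :: "int \<Rightarrow> int \<Rightarrow> int \<Rightarrow> int \<Rightarrow> bool" where
  "signed_coprime3 n a b c \<longleftrightarrow>
     (\<forall>e\<in>{-1,0,1}. \<forall>f\<in>{-1,0,1}. \<forall>g\<in>{-1,0,1}. e \<noteq> 0 \<or> f \<noteq> 0 \<or> g \<noteq> 0 \<longrightarrow>
        coprime (e * a + f * b + g * c) n)"

definition signed_coprime4 :: "int \<Rightarrow> int \<Rightarrow> int \<Rightarrow> int \<Rightarrow> int \<Rightarrow> bool" where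
  "signed_coprime4 n a b c d \<longleftrightarrow>
     (\<forall>e\<in>{-1,0,1}. \<forall>f\<in>{-1,0,1}. \<forall>g\<in>{-1,0,1}. \<forall>h\<in>{-1,0,1}.
        e \<noteq> 0 \<or> f \<noteq> 0 \<or> g \<noteq> 0 \<or> h \<noteq> 0 \<longrightarrow> coprime (e * a + f * b + g * c + h * d) n)"

text \<open>These are the slopes met in a square with entries congruent to
  \<open>a * x + b * y + d\<close>: a line with \<open>y\<close> fixed, a line with \<open>x\<close>
  fixed, and the broken diagonals in the two directions.\<close>

lemma signed_coprime2D:
  assumes "signed_coprime2 n a b"
  shows "coprime a n" "coprime b n" "coprime (a + b) n" "coprime (a - b) n"
proof -
  have *: "coprime (e * a + f * b) n" if "e \<in> {-1,0,1}" "f \<in> {-1,0,1}" "e \<noteq> 0 \<or> f \<noteq> 0" for e f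
    using assms that unfolding signed_coprime2_def by blast
  show "coprime a n" "coprime b n" "coprime (a + b) n" "coprime (a - b) n"
    using *[of 1 0] *[of 0 1] *[of 1 1] *[of 1 "-1"] by simp_all
qed

lemma signed_coprime2_swap:
  assumes "signed_coprime2 n a b"
  shows "signed_coprime2 n b a"
  unfolding signed_coprime2_def
proof (intro ballI impI)
  fix e f :: int
  assume "e \<in> {-1,0,1}" "f \<in> {-1,0,1}"
    and "e \<noteq> 0 \<or> f \<noteq> 0"
  then have "coprime (f * a + e * b) n"
    using assms unfolding signed_coprime2_def by blast
  then show "coprime (e * b + f * a) n"
    by (simp add: add_ac)
qed

text \<open>\<open>signed_coprime3_merge\<close> acts on the first two coefficients only. Adjacent
  transpositions generate all permutations, so they bring any chosen pair to the front.\<close>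

lemma signed_coprime3_swap12:
  assumes "signed_coprime3 n a b c"
  shows "signed_coprime3 n b a c"
  unfolding signed_coprime3_def
proof (intro ballI impI)
  fix e f g :: int
  assume "e \<in> {-1,0,1}" "f \<in> {-1,0,1}" "g \<in> {-1,0,1}"
    and "e \<noteq> 0 \<or> f \<noteq> 0 \<or> g \<noteq> 0"
  then have "coprime (f * a + e * b + g * c) n"
    using assms unfolding signed_coprime3_def by blast
  then show "coprime (e * b + f * a + g * c) n"
    by (simp add: add_ac)
qed

lemma signed_coprime3_swap23:
  assumes "signed_coprime3 n a b c"
  shows "signed_coprime3 n a c b"
  unfolding signed_coprime3_def
proof (intro ballI impI)
  fix e f g :: int
  assume "e \<in> {-1,0,1}" "f \<in> {-1,0,1}" "g \<in> {-1,0,1}"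
    and "e \<noteq> 0 \<or> f \<noteq> 0 \<or> g \<noteq> 0"
  then have "coprime (e * a + g * b + f * c) n"
    using assms unfolding signed_coprime3_def by blast
  then show "coprime (e * a + f * c + g * b) n"
    by (simp add: add_ac)
qed

text \<open>This is the passage from a cube to its constituent squares: fixing a coordinate drops
  its coefficient, \<open>x = y\<close> adds two coefficients, and \<open>x + y = n - 1\<close>
  subtracts them.\<close>

lemma signed_coprime3_merge:
  assumes "signed_coprime3 n a b c"
  shows "signed_coprime2 n b c" "signed_coprime2 n (a + b) c" "signed_coprime2 n (a - b) c"
proof -
  have *: "coprime (e * a + f * b + g * c) n"
    if "e \<in> {-1,0,1}" "f \<in> {-1,0,1}" "g \<in> {-1,0,1}" "e \<noteq> 0 \<or> f \<noteq> 0 \<or> g \<noteq> 0" for e f g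
    using assms that unfolding signed_coprime3_def by blast
  show "signed_coprime2 n b c"
    unfolding signed_coprime2_def using *[of 0] by simp
  \<comment> \<open>Expanding the merged coefficient gives the sign patterns
    \<open>(e, e, f)\<close> and \<open>(e, -e, f)\<close>. They stay in {-1, 0, 1} and are nonzero
    whenever \<open>(e, f)\<close> is.\<close>
  have "coprime (e * (a + b) + f * c) n \<and> coprime (e * (a - b) + f * c) n"
    if "e \<in> {-1,0,1}" "f \<in> {-1,0,1}" "e \<noteq> 0 \<or> f \<noteq> 0" for e f
    using *[of e e f] *[of e "-e" f] that by (auto simp: algebra_simps)
  then show "signed_coprime2 n (a + b) c" "signed_coprime2 n (a - b) c"
    unfolding signed_coprime2_def by blast+
qed

lemma signed_coprime4_swap12:
  assumes "signed_coprime4 n a b c d"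
  shows "signed_coprime4 n b a c d"
  unfolding signed_coprime4_def
proof (intro ballI impI)
  fix e f g h :: int
  assume "e \<in> {-1,0,1}" "f \<in> {-1,0,1}" "g \<in> {-1,0,1}" "h \<in> {-1,0,1}"
    and "e \<noteq> 0 \<or> f \<noteq> 0 \<or> g \<noteq> 0 \<or> h \<noteq> 0"
  then have "coprime (f * a + e * b + g * c + h * d) n"
    using assms unfolding signed_coprime4_def by blast
  then show "coprime (e * b + f * a + g * c + h * d) n"
    by (simp add: add_ac)
qed

lemma signed_coprime4_swap23:
  assumes "signed_coprime4 n a b c d"
  shows "signed_coprime4 n a c b d"
  unfolding signed_coprime4_def
proof (intro ballI impI)
  fix e f g h :: int
  assume "e \<in> {-1,0,1}" "f \<in> {-1,0,1}" "g \<in> {-1,0,1}" "h \<in> {-1,0,1}"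
    and "e \<noteq> 0 \<or> f \<noteq> 0 \<or> g \<noteq> 0 \<or> h \<noteq> 0"
  then have "coprime (e * a + g * b + f * c + h * d) n"
    using assms unfolding signed_coprime4_def by blast
  then show "coprime (e * a + f * c + g * b + h * d) n"
    by (simp add: add_ac)
qed

lemma signed_coprime4_swap34:
  assumes "signed_coprime4 n a b c d"
  shows "signed_coprime4 n a b d c"
  unfolding signed_coprime4_def
proof (intro ballI impI)
  fix e f g h :: int
  assume "e \<in> {-1,0,1}" "f \<in> {-1,0,1}" "g \<in> {-1,0,1}" "h \<in> {-1,0,1}"
    and "e \<noteq> 0 \<or> f \<noteq> 0 \<or> g \<noteq> 0 \<or> h \<noteq> 0"
  then have "coprime (e * a + f * b + h * c + g * d) n"
    using assms unfolding signed_coprime4_def by blast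
  then show "coprime (e * a + f * b + g * d + h * c) n"
    by (simp add: add_ac)
qed

text \<open>The same passage one dimension higher, from the 4-D array to its constituent
  cubes.\<close>

lemma signed_coprime4_merge:
  assumes "signed_coprime4 n a b c d"
  shows "signed_coprime3 n b c d" "signed_coprime3 n (a + b) c d" "signed_coprime3 n (a - b) c d"
proof -
  have *: "coprime (e * a + f * b + g * c + h * d) n"
    if "e \<in> {-1,0,1}" "f \<in> {-1,0,1}" "g \<in> {-1,0,1}" "h \<in> {-1,0,1}"
      "e \<noteq> 0 \<or> f \<noteq> 0 \<or> g \<noteq> 0 \<or> h \<noteq> 0" for e f g h
    using assms that unfolding signed_coprime4_def by blast
  show "signed_coprime3 n b c d"
    unfolding signed_coprime3_def using *[of 0] by simp
  have "coprime (e * (a + b) + f * c + g * d) n \<and> coprime (e * (a - b) + f * c + g * d) n"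
    if "e \<in> {-1,0,1}" "f \<in> {-1,0,1}" "g \<in> {-1,0,1}" "e \<noteq> 0 \<or> f \<noteq> 0 \<or> g \<noteq> 0" for e f g
    using *[of e e f g] *[of e "-e" f g] that by (auto simp: algebra_simps)
  then show "signed_coprime3 n (a + b) c d" "signed_coprime3 n (a - b) c d"
    unfolding signed_coprime3_def by blast+
qed

section \<open>Affine lines and squares modulo \<open>n\<close>\<close>

lemma each_once_affine:
  fixes n a d :: int
  assumes n: "n > 0" and a: "coprime a n"
    and f: "\<And>x. x \<in> symbols n \<Longrightarrow> f x \<in> symbols n \<and> [f x = a * x + d] (mod n)"
  shows "each_once n f"
  unfolding each_once_def
proof
  \<comment> \<open>Cancelling \<open>d\<close> and then the unit \<open>a\<close> leaves
    \<open>x\<close> congruent to \<open>y\<close>, and distinct elements of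
    \<open>symbols n\<close> are incongruent.\<close>
  have inj: "inj_on f (symbols n)"
  proof (rule inj_onI)
    fix x y assume xy: "x \<in> symbols n" "y \<in> symbols n" "f x = f y"
    then have "[a * x + d = a * y + d] (mod n)"
      using f by (metis cong_sym cong_trans)
    then have "[x = y] (mod n)"
      using a by (simp add: cong_add_rcancel cong_mult_lcancel)
    then show "x = y"
      using xy by (simp add: symbols_def cong_def)
  qed
  \<comment> \<open>An injective map of a finite set into itself is onto.\<close>
  have surj: "f ` symbols n = symbols n"
    using inj f by (intro endo_inj_surj) (auto simp: symbols_def)
  fix s assume "s \<in> symbols n"
  then have "s \<in> f ` symbols n"
    by (simp only: surj)
  then obtain x where "x \<in> symbols n" "f x = s"
    by (elim imageE) simp
  then show "\<exists>!x. x \<in> symbols n \<and> f x = s"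
    using inj_onD[OF inj] by (intro ex1I[of _ x]) simp_all
qed

lemma pandiagonal_latin_square_affine:
  fixes n a b d :: int
  assumes n: "n > 0" and ab: "signed_coprime2 n a b"
    and A: "\<And>x y. x \<in> symbols n \<Longrightarrow> y \<in> symbols n \<Longrightarrow>
              A x y \<in> symbols n \<and> [A x y = a * x + b * y + d] (mod n)"
  shows "pandiagonal_latin_square n A"
  unfolding pandiagonal_latin_square_def
proof (intro conjI ballI)
  show "A x y \<in> symbols n" if "x \<in> symbols n" "y \<in> symbols n" for x y
    using A that by blast
next
  fix c assume c: "c \<in> symbols n"
  have mod_symbols: "t mod n \<in> symbols n" for t
    using n by (simp add: symbols_def)
  \<comment> \<open>Broken diagonals wrap around. The reduced index lies in
    \<open>symbols n\<close>, where \<open>A\<close> is known, while the congruence may be computed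
    with the unreduced \<open>t\<close>, which is linear in \<open>x\<close>.\<close>
  have mod_cong: "[A x (t mod n) = a * x + b * t + d] (mod n)" if "x \<in> symbols n" for x t
  proof -
    have "[a * x + b * (t mod n) + d = a * x + b * t + d] (mod n)"
      by (intro cong_add cong_mult) (simp_all add: cong_def)
    then show ?thesis
      using A[OF that mod_symbols] cong_trans by blast
  qed
  show "each_once n (\<lambda>x. A x c)"
    by (rule each_once_affine[where a = a and d = "b * c + d"])
       (use n signed_coprime2D[OF ab] A[OF _ c] in \<open>simp_all add: algebra_simps\<close>)
  show "each_once n (\<lambda>y. A c y)"
    by (rule each_once_affine[where a = b and d = "a * c + d"])
       (use n signed_coprime2D[OF ab] A[OF c] in \<open>simp_all add: algebra_simps\<close>)
  show "each_once n (\<lambda>x. A x ((x + c) mod n))"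
  proof (rule each_once_affine[where a = "a + b" and d = "b * c + d"])
    show "A x ((x + c) mod n) \<in> symbols n \<and>
        [A x ((x + c) mod n) = (a + b) * x + (b * c + d)] (mod n)" if "x \<in> symbols n" for x
      using mod_cong[OF that, of "x + c"] A[OF that mod_symbols] by (simp add: algebra_simps)
  qed (use n signed_coprime2D[OF ab] in auto)
  show "each_once n (\<lambda>x. A x ((c - x) mod n))"
  proof (rule each_once_affine[where a = "a - b" and d = "b * c + d"])
    show "A x ((c - x) mod n) \<in> symbols n \<and>
        [A x ((c - x) mod n) = (a - b) * x + (b * c + d)] (mod n)" if "x \<in> symbols n" for x
      using mod_cong[OF that, of "c - x"] A[OF that mod_symbols] by (simp add: algebra_simps)
  qed (use n signed_coprime2D[OF ab] in auto)
qed

section \<open>Affine cubes of dimension three and four\<close>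

lemma reflect_symbols: "x \<in> symbols n \<Longrightarrow> n - 1 - x \<in> symbols n"
  by (simp add: symbols_def)

text \<open>Every constituent square is again affine, with coefficients supplied by the merge lemma.
  The constant \<open>d\<close> is arbitrary so that it can absorb what a fixed or reflected
  coordinate contributes.\<close>

lemma pandiagonal_latin_cube_affine:
  fixes n a b c d :: int
  assumes n: "n > 0" and abc: "signed_coprime3 n a b c"
    and C: "\<And>x y z. x \<in> symbols n \<Longrightarrow> y \<in> symbols n \<Longrightarrow> z \<in> symbols n \<Longrightarrow>
              C x y z \<in> symbols n \<and> [C x y z = a * x + b * y + c * z + d] (mod n)"
  shows "pandiagonal_latin_cube n C"
proof -
  note sq = pandiagonal_latin_square_affine[OF n]
  note acb = signed_coprime3_swap23[OF abc] and bac = signed_coprime3_swap12[OF abc]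
  note bca = signed_coprime3_swap23[OF bac] and cab = signed_coprime3_swap12[OF acb]
  \<comment> \<open>All coefficient pairs of constituent squares. The last group is swapped because
    in the squares relating \<open>y\<close> and \<open>z\<close> the merged coefficient belongs to
    the second index.\<close>
  note co = signed_coprime3_merge[OF abc] signed_coprime3_merge[OF acb]
    signed_coprime3_merge[OF bac] signed_coprime3_merge[OF cab]
    signed_coprime3_merge[OF bca, THEN signed_coprime2_swap]
  \<comment> \<open>With a free right-hand side \<open>t\<close>, this rule matches whatever affine
    form a square asks for and leaves only a ring identity.\<close>
  have C': "C x y z \<in> symbols n \<and> [C x y z = t] (mod n)"
    if "x \<in> symbols n" "y \<in> symbols n" "z \<in> symbols n" "t = a * x + b * y + c * z + d" for x y z t
    using C that by blast
  have 1: "pandiagonal_latin_square n (\<lambda>y z. C c' y z)" if "c' \<in> symbols n" for c'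
    by (rule sq[where a = b and b = c and d = "a * c' + d"])
       (rule co C' reflect_symbols that | assumption | simp add: algebra_simps)+
  have 2: "pandiagonal_latin_square n (\<lambda>x z. C x c' z)" if "c' \<in> symbols n" for c'
    by (rule sq[where a = a and b = c and d = "b * c' + d"])
       (rule co C' reflect_symbols that | assumption | simp add: algebra_simps)+
  have 3: "pandiagonal_latin_square n (\<lambda>x y. C x y c')" if "c' \<in> symbols n" for c'
    by (rule sq[where a = a and b = b and d = "c * c' + d"])
       (rule co C' reflect_symbols that | assumption | simp add: algebra_simps)+
  have 4: "pandiagonal_latin_square n (\<lambda>x z. C x x z)"
    by (rule sq[where a = "a + b" and b = c and d = d])
       (rule co C' reflect_symbols | assumption | simp add: algebra_simps)+
  \<comment> \<open>Since \<open>b * (n - 1 - x) = b * (n - 1) - b * x\<close>, a reflection negates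
    the coefficient and adds a constant; the other reflected squares work alike.\<close>
  have 5: "pandiagonal_latin_square n (\<lambda>x z. C x (n - 1 - x) z)"
    by (rule sq[where a = "a - b" and b = c and d = "b * (n - 1) + d"])
       (rule co C' reflect_symbols | assumption | simp add: algebra_simps)+
  have 6: "pandiagonal_latin_square n (\<lambda>x y. C x y x)"
    by (rule sq[where a = "a + c" and b = b and d = d])
       (rule co C' reflect_symbols | assumption | simp add: algebra_simps)+
  have 7: "pandiagonal_latin_square n (\<lambda>x y. C x y (n - 1 - x))"
    by (rule sq[where a = "a - c" and b = b and d = "c * (n - 1) + d"])
       (rule co C' reflect_symbols | assumption | simp add: algebra_simps)+
  have 8: "pandiagonal_latin_square n (\<lambda>x y. C x y y)"
    by (rule sq[where a = a and b = "b + c" and d = d])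
       (rule co C' reflect_symbols | assumption | simp add: algebra_simps)+
  have 9: "pandiagonal_latin_square n (\<lambda>x y. C x y (n - 1 - y))"
    by (rule sq[where a = a and b = "b - c" and d = "c * (n - 1) + d"])
       (rule co C' reflect_symbols | assumption | simp add: algebra_simps)+
  show ?thesis
    unfolding pandiagonal_latin_cube_def
  proof (intro conjI ballI)
    show "pandiagonal_latin_square n A" if "A \<in> constituent_squares n C" for A
      using that unfolding constituent_squares_def
      by (elim UnE UN_E insertE emptyE) (simp_all only: 1 2 3 4 5 6 7 8 9)
  qed (use C in blast)
qed

lemma pandiagonal_latin_cube_4D_affine:
  fixes n a b c d :: int
  assumes n: "n > 0" and abcd: "signed_coprime4 n a b c d"
    and H: "\<And>i j k l. i \<in> symbols n \<Longrightarrow> j \<in> symbols n \<Longrightarrow> k \<in> symbols n \<Longrightarrow> l \<in> symbols n \<Longrightarrow>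
              H i j k l \<in> symbols n \<and> [H i j k l = a * i + b * j + c * k + d * l] (mod n)"
  shows "pandiagonal_latin_cube_4D n H"
proof -
  note cube = pandiagonal_latin_cube_affine[OF n]
  note acbd = signed_coprime4_swap23[OF abcd] and bacd = signed_coprime4_swap12[OF abcd]
  note acdb = signed_coprime4_swap34[OF acbd] and abdc = signed_coprime4_swap34[OF abcd]
  note cabd = signed_coprime4_swap12[OF acbd] and adbc = signed_coprime4_swap23[OF abdc]
  note bcad = signed_coprime4_swap23[OF bacd] and badc = signed_coprime4_swap34[OF bacd]
  note dabc = signed_coprime4_swap12[OF adbc] and bdac = signed_coprime4_swap23[OF badc]
  note cadb = signed_coprime4_swap12[OF acdb]
  note cdab = signed_coprime4_swap23[OF cadb]
  \<comment> \<open>Merging always produces the new coefficient in first place. The swaps after the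
    last three merges move it to the place of the surviving index: second for \<open>b\<close> with
    \<open>c\<close> or \<open>d\<close>, third for \<open>c\<close> with \<open>d\<close>.\<close>
  note co = signed_coprime4_merge[OF abcd] signed_coprime4_merge[OF acbd]
    signed_coprime4_merge[OF adbc] signed_coprime4_merge[OF bacd]
    signed_coprime4_merge[OF cabd] signed_coprime4_merge[OF dabc]
    signed_coprime4_merge[OF bcad, THEN signed_coprime3_swap12]
    signed_coprime4_merge[OF bdac, THEN signed_coprime3_swap12]
    signed_coprime4_merge[OF cdab, THEN signed_coprime3_swap12, THEN signed_coprime3_swap23]
  have H': "H i j k l \<in> symbols n \<and> [H i j k l = t] (mod n)"
    if "i \<in> symbols n" "j \<in> symbols n" "k \<in> symbols n" "l \<in> symbols n"
      "t = a * i + b * j + c * k + d * l" for i j k l t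
    using H that by blast
  have 1: "pandiagonal_latin_cube n (\<lambda>j k l. H c' j k l)" if "c' \<in> symbols n" for c'
    by (rule cube[where a = b and b = c and c = d and d = "a * c'"])
       (rule co H' reflect_symbols that | assumption | simp add: algebra_simps)+
  have 2: "pandiagonal_latin_cube n (\<lambda>i k l. H i c' k l)" if "c' \<in> symbols n" for c'
    by (rule cube[where a = a and b = c and c = d and d = "b * c'"])
       (rule co H' reflect_symbols that | assumption | simp add: algebra_simps)+
  have 3: "pandiagonal_latin_cube n (\<lambda>i j l. H i j c' l)" if "c' \<in> symbols n" for c'
    by (rule cube[where a = a and b = b and c = d and d = "c * c'"])
       (rule co H' reflect_symbols that | assumption | simp add: algebra_simps)+
  have 4: "pandiagonal_latin_cube n (\<lambda>i j k. H i j k c')" if "c' \<in> symbols n" for c'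
    by (rule cube[where a = a and b = b and c = c and d = "d * c'"])
       (rule co H' reflect_symbols that | assumption | simp add: algebra_simps)+
  have 5: "pandiagonal_latin_cube n (\<lambda>i k l. H i i k l)"
    by (rule cube[where a = "a + b" and b = c and c = d and d = 0])
       (rule co H' reflect_symbols | assumption | simp add: algebra_simps)+
  have 6: "pandiagonal_latin_cube n (\<lambda>i k l. H i (n - 1 - i) k l)"
    by (rule cube[where a = "a - b" and b = c and c = d and d = "b * (n - 1)"])
       (rule co H' reflect_symbols | assumption | simp add: algebra_simps)+
  have 7: "pandiagonal_latin_cube n (\<lambda>i j l. H i j i l)"
    by (rule cube[where a = "a + c" and b = b and c = d and d = 0])
       (rule co H' reflect_symbols | assumption | simp add: algebra_simps)+
  have 8: "pandiagonal_latin_cube n (\<lambda>i j l. H i j (n - 1 - i) l)"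
    by (rule cube[where a = "a - c" and b = b and c = d and d = "c * (n - 1)"])
       (rule co H' reflect_symbols | assumption | simp add: algebra_simps)+
  have 9: "pandiagonal_latin_cube n (\<lambda>i j k. H i j k i)"
    by (rule cube[where a = "a + d" and b = b and c = c and d = 0])
       (rule co H' reflect_symbols | assumption | simp add: algebra_simps)+
  have 10: "pandiagonal_latin_cube n (\<lambda>i j k. H i j k (n - 1 - i))"
    by (rule cube[where a = "a - d" and b = b and c = c and d = "d * (n - 1)"])
       (rule co H' reflect_symbols | assumption | simp add: algebra_simps)+
  have 11: "pandiagonal_latin_cube n (\<lambda>i j l. H i j j l)"
    by (rule cube[where a = a and b = "b + c" and c = d and d = 0])
       (rule co H' reflect_symbols | assumption | simp add: algebra_simps)+
  have 12: "pandiagonal_latin_cube n (\<lambda>i j l. H i j (n - 1 - j) l)"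
    by (rule cube[where a = a and b = "b - c" and c = d and d = "c * (n - 1)"])
       (rule co H' reflect_symbols | assumption | simp add: algebra_simps)+
  have 13: "pandiagonal_latin_cube n (\<lambda>i j k. H i j k j)"
    by (rule cube[where a = a and b = "b + d" and c = c and d = 0])
       (rule co H' reflect_symbols | assumption | simp add: algebra_simps)+
  have 14: "pandiagonal_latin_cube n (\<lambda>i j k. H i j k (n - 1 - j))"
    by (rule cube[where a = a and b = "b - d" and c = c and d = "d * (n - 1)"])
       (rule co H' reflect_symbols | assumption | simp add: algebra_simps)+
  have 15: "pandiagonal_latin_cube n (\<lambda>i j k. H i j k k)"
    by (rule cube[where a = a and b = b and c = "c + d" and d = 0])
       (rule co H' reflect_symbols | assumption | simp add: algebra_simps)+
  have 16: "pandiagonal_latin_cube n (\<lambda>i j k. H i j k (n - 1 - k))"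
    by (rule cube[where a = a and b = b and c = "c - d" and d = "d * (n - 1)"])
       (rule co H' reflect_symbols | assumption | simp add: algebra_simps)+
  show ?thesis
    unfolding pandiagonal_latin_cube_4D_def
  proof (intro conjI ballI)
    show "pandiagonal_latin_cube n A" if "A \<in> constituent_cubes n H" for A
      using that unfolding constituent_cubes_def
      by (elim UnE UN_E insertE emptyE) (simp_all only: 1 2 3 4 5 6 7 8 9 10 11 12 13 14 15 16)
  qed (use H in blast)
qed

section \<open>From the gcd conditions to the pandiagonal property\<close>

theorem mainTheorem7:
  fixes n B :: int
    and \<alpha> :: "nat \<Rightarrow> int"
    and H :: "int \<Rightarrow> int \<Rightarrow> int \<Rightarrow> int \<Rightarrow> int"
  assumes "n > 0" and "odd n"
    and "\<And>m. m \<in> {1..4} \<Longrightarrow> \<alpha> m \<in> {1..n - 1}"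
    and "\<And>i j k l. i \<in> symbols n \<Longrightarrow> j \<in> symbols n \<Longrightarrow> k \<in> symbols n \<Longrightarrow> l \<in> symbols n \<Longrightarrow>
           H i j k l \<in> symbols n \<and>
           [H i j k l = \<alpha> 1 * i + \<alpha> 2 * j + \<alpha> 3 * k + \<alpha> 4 * l] (mod n)"
    and "B = \<alpha> 1 + \<alpha> 2 + \<alpha> 3 + \<alpha> 4"
    and "\<And>m m'. m \<in> {1..4} \<Longrightarrow> m' \<in> {1..4} \<Longrightarrow> m' \<noteq> m \<Longrightarrow>
           gcd (\<alpha> m) n = 1 \<and>
           gcd (\<alpha> m + \<alpha> m') n = 1 \<and>
           gcd (\<alpha> m - \<alpha> m') n = 1 \<and>
           gcd (B - \<alpha> m) n = 1 \<and>
           gcd B n = 1 \<and>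
           gcd (B - 2 * \<alpha> m) n = 1 \<and>
           gcd (B - \<alpha> m' - 2 * \<alpha> m) n = 1 \<and>
           gcd (B - 2 * \<alpha> m' - 2 * \<alpha> m) n = 1"
  shows "pandiagonal_latin_cube_4D n H"
proof -
  \<comment> \<open>There are 80 nonzero sign patterns, hence 40 up to a global sign. The eight
    families cover them in 4 + 6 + 6 + 4 + 1 + 4 + 12 + 3 patterns. Stating each fact for
    \<open>s\<close> with both signs lets every pattern match directly.\<close>
  have co: "s = \<alpha> m \<or> s = - \<alpha> m \<Longrightarrow> coprime s n"
    "s = \<alpha> m + \<alpha> m' \<or> s = - (\<alpha> m + \<alpha> m') \<Longrightarrow> coprime s n"
    "s = \<alpha> m - \<alpha> m' \<or> s = - (\<alpha> m - \<alpha> m') \<Longrightarrow> coprime s n"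
    "s = B - \<alpha> m \<or> s = - (B - \<alpha> m) \<Longrightarrow> coprime s n"
    "s = B \<or> s = - B \<Longrightarrow> coprime s n"
    "s = B - 2 * \<alpha> m \<or> s = - (B - 2 * \<alpha> m) \<Longrightarrow> coprime s n"
    "s = B - \<alpha> m' - 2 * \<alpha> m \<or> s = - (B - \<alpha> m' - 2 * \<alpha> m) \<Longrightarrow> coprime s n"
    "s = B - 2 * \<alpha> m' - 2 * \<alpha> m \<or> s = - (B - 2 * \<alpha> m' - 2 * \<alpha> m) \<Longrightarrow> coprime s n"
    if "m \<in> {1..4}" "m' \<in> {1..4}" "m' \<noteq> m" for m m' s
    using assms(6)[OF that] by (auto simp only: coprime_iff_gcd_eq_1 gcd_neg1_int)
  \<comment> \<open>Ordered pairs are listed because \<open>B - \<alpha> m' - 2 * \<alpha> m\<close>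
    is not symmetric in \<open>m\<close> and \<open>m'\<close>.\<close>
  note pairs = co[where m = 1 and m' = 2] co[where m = 1 and m' = 3]
    co[where m = 1 and m' = 4] co[where m = 2 and m' = 1] co[where m = 2 and m' = 3]
    co[where m = 2 and m' = 4] co[where m = 3 and m' = 1] co[where m = 3 and m' = 2]
    co[where m = 3 and m' = 4] co[where m = 4 and m' = 1] co[where m = 4 and m' = 2]
    co[where m = 4 and m' = 3]
  have "signed_coprime4 n (\<alpha> 1) (\<alpha> 2) (\<alpha> 3) (\<alpha> 4)"
    unfolding signed_coprime4_def
    \<comment> \<open>Simplification expands the quantifiers over {-1, 0, 1} into finitely many
      coprimality goals; deleting \<open>One_nat_def\<close> keeps \<open>\<alpha> 1\<close> in the
      form used in \<open>pairs\<close>. For each goal the search backtracks through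
      \<open>pairs\<close> until \<open>linarith\<close> confirms that the combination is the listed
      one up to sign.\<close>
    by (simp del: One_nat_def, intro conjI)
       (rule pairs[unfolded assms(5)], (simp; fail), (simp; fail), (simp; fail), linarith)+
  then show ?thesis
    by (rule pandiagonal_latin_cube_4D_affine[OF assms(1) _ assms(4)])
qed

end
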